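(* Let $C$ be a $[g_q(k,d),k,d]_q$ Griesmer code and let $e\ge 0$ be an integer with $q^e\mid d$. Then there exists a generator matrix $G$ of $C$ (with rows $a_1,\dots,a_k$) such that the first $\min\{e+1,k\}$ rows of $G$ span a Griesmer subcode in which every nonzero codeword has weight $d$, and such that any $k-1$ rows of $G$ generate a $[g_q(k-1,d),k-1,d]_q$ Griesmer subcode.
   Context: An $[n,k,d]_q$ code is a $k$-dimensional subspace of $\mathbb{F}_q^n$ with minimum nonzero Hamming weight $d$; $g_q(k,d)=\sum_{i=0}^{k-1}\lceil d/q^i\rceil$. A code (or subcode) of dimension $k'$ and minimum weight $d'$ is a Griesmer code if its effective length, i.e., the number of coordinates at which not all of its codewords vanish, equals $g_q(k',d')$. The code $C$ is assumed to have full length. *)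

theory Defs
  imports "HOL-Analysis.Analysis"
begin

text \<open>
  The field of order \<open>q\<close> is a type \<open>'a\<close> of class field and finite, with \<open>q = CARD('a)\<close>; words of
  length \<open>n = CARD('n)\<close> are the vectors of type \<open>'a ^ 'n\<close>.
\<close>

definition hamming_weight :: "'a::zero ^ 'n \<Rightarrow> nat" where
  "hamming_weight x = card {i. x $ i \<noteq> 0}"

definition effective_length :: "('a::zero ^ 'n) set \<Rightarrow> nat" where
  "effective_length C = card {i. \<exists>x\<in>C. x $ i \<noteq> 0}"

definition full_length :: "('a::zero ^ 'n) set \<Rightarrow> bool" where
  "full_length C \<longleftrightarrow> (\<forall>i. \<exists>x\<in>C. x $ i \<noteq> 0)"

text \<open>The zero code has no minimum nonzero weight, so \<open>linear_code k d C\<close> forces \<open>k \<ge> 1\<close> and \<open>d \<ge> 1\<close>.\<close>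

definition linear_code :: "nat \<Rightarrow> nat \<Rightarrow> ('a::{field,finite} ^ 'n) set \<Rightarrow> bool" where
  "linear_code k d C \<longleftrightarrow> vec.subspace C \<and> vec.dim C = k \<and>
     (\<exists>x\<in>C. x \<noteq> 0 \<and> hamming_weight x = d) \<and>
     (\<forall>x\<in>C. x \<noteq> 0 \<longrightarrow> d \<le> hamming_weight x)"

definition griesmer_bound :: "nat \<Rightarrow> nat \<Rightarrow> nat \<Rightarrow> nat" where
  "griesmer_bound q k d = (\<Sum>i<k. nat \<lceil>real d / real q ^ i\<rceil>)"

text \<open>
  Subcodes keep the ambient length, so the Griesmer property is about the effective length.
\<close>

definition griesmer_code :: "nat \<Rightarrow> nat \<Rightarrow> ('a::{field,finite} ^ 'n) set \<Rightarrow> bool" where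
  "griesmer_code k d C \<longleftrightarrow>
     linear_code k d C \<and> effective_length C = griesmer_bound CARD('a) k d"

text \<open>
  As \<open>k\<close> is a number, a matrix with \<open>k\<close> rows is given by its rows \<open>a 0, \<dots>, a (k - 1)\<close>; the values
  \<open>a i\<close> for \<open>i \<ge> k\<close> are irrelevant.
\<close>

definition generator_matrix :: "nat \<Rightarrow> (nat \<Rightarrow> 'a::field ^ 'n) \<Rightarrow> ('a ^ 'n) set \<Rightarrow> bool" where
  "generator_matrix k a C \<longleftrightarrow> inj_on a {..<k} \<and> vec.independent (a ` {..<k}) \<and>
     vec.span (a ` {..<k}) = C"

end

theory Submission
  imports Defs
begin

text \<open>
  Order the subcodes of \<open>C\<close> by inclusion and call a subcode of dimension \<open>j\<close> tight if its effective
  length is \<open>g\<^sub>q(j,d)\<close>, the least possible value. For \<open>D \<subseteq> F\<close> of codimension two, each coordinate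
  outside the support of \<open>D\<close> but in that of \<open>F\<close> vanishes on exactly one of the \<open>q + 1\<close> codes
  in between; averaging over these \<open>q + 1\<close> codes gives the Griesmer bound relative to \<open>D\<close>, hence
  tight extensions of tight subcodes, and even two different ones when the codimension of \<open>D\<close> is at
  least two. So every tight \<open>D\<close> is the intersection of the tight hyperplanes of \<open>C\<close> containing it.
  Take a tight \<open>D\<close> of dimension \<open>min (e + 1) k\<close>; the divisibility of \<open>d\<close> makes the averages exact,
  so \<open>D\<close> has constant weight. Tight hyperplanes \<open>E\<^sub>i\<close> with intersection \<open>0\<close>, all but the first
  \<open>dim D\<close> of which intersect in \<open>D\<close>, have as their dual basis the required rows:
  \<open>a\<^sub>i\<close> spans the intersection of the \<open>E\<^sub>j\<close> with \<open>j \<noteq> i\<close>.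
\<close>

section \<open>The Griesmer bound\<close>

definition griesmer_term :: "nat \<Rightarrow> nat \<Rightarrow> nat \<Rightarrow> nat" where
  "griesmer_term q d i = nat \<lceil>real d / real q ^ i\<rceil>"

text \<open>The upper bounds of a ceiling determine it, so this trades real division for an
  inequality between natural numbers.\<close>

lemma griesmer_term_le_iff:
  assumes "q > 0"
  shows "griesmer_term q d i \<le> m \<longleftrightarrow> d \<le> m * q ^ i"
proof -
  have "griesmer_term q d i \<le> m \<longleftrightarrow> real d / real q ^ i \<le> real m"
    by (simp add: griesmer_term_def nat_le_iff ceiling_le_iff)
  also have "\<dots> \<longleftrightarrow> real d \<le> real (m * q ^ i)"
    using assms by (simp add: pos_divide_le_eq)
  finally show ?thesis by (simp only: of_nat_le_iff)
qed

lemma griesmer_term_0 [simp]: "griesmer_term q d 0 = d"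
  by (simp add: griesmer_term_def)

text \<open>Nested ceilings collapse: both sides have the same upper bounds \<open>m\<close>, namely
  those with \<open>d \<le> m * q ^ (i + j)\<close>.\<close>

lemma griesmer_term_add:
  assumes "q > 0"
  shows "griesmer_term q d (i + j) = griesmer_term q (griesmer_term q d i) j"
proof -
  have "griesmer_term q d (i + j) \<le> m \<longleftrightarrow> griesmer_term q (griesmer_term q d i) j \<le> m" for m
    by (simp add: griesmer_term_le_iff[OF assms] power_add mult_ac)
  then show ?thesis using order_antisym by blast
qed

lemma griesmer_term_mono:
  assumes "q > 0" "d \<le> d'"
  shows "griesmer_term q d i \<le> griesmer_term q d' i"
  using griesmer_term_le_iff[OF assms(1), of d' i "griesmer_term q d' i"] assms
  by (simp add: griesmer_term_le_iff)

text \<open>Rounding up to a multiple of \<open>q\<close> adds less than \<open>q\<close>. The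
  strictness is what later yields a second tight extension.\<close>

lemma griesmer_term_Suc_less:
  assumes "q > 0"
  shows "q * griesmer_term q d (Suc i) < griesmer_term q d i + q"
proof -
  let ?w = "griesmer_term q d i"
  have "\<not> ?w + q \<le> q * griesmer_term q ?w 1"
  proof
    assume *: "?w + q \<le> q * griesmer_term q ?w 1"
    then obtain t where t: "griesmer_term q ?w 1 = Suc t"
      using assms by (cases "griesmer_term q ?w 1") auto
    with * have "?w \<le> t * q ^ 1" by (simp add: mult_ac)
    then have "griesmer_term q ?w 1 \<le> t" by (simp only: griesmer_term_le_iff[OF assms])
    with t show False by simp
  qed
  then show ?thesis using griesmer_term_add[OF assms, of d i 1] by simp
qed

text \<open>Under divisibility no rounding occurs. This is the source of the exact averages behind
  constant weight.\<close>

lemma griesmer_term_Suc_dvd: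
  assumes "q > 0" "q ^ Suc i dvd d"
  shows "griesmer_term q d i = q * griesmer_term q d (Suc i)"
proof -
  obtain t where t: "d = q ^ Suc i * t" using assms by blast
  have "griesmer_term q d j = c" if "d = c * q ^ j" for j c
    using assms(1) that by (simp add: griesmer_term_def)
  from this[of "q * t" i] this[of t "Suc i"] t show ?thesis by simp
qed

lemma griesmer_bound_0 [simp]: "griesmer_bound q 0 d = 0"
  by (simp add: griesmer_bound_def)

lemma griesmer_bound_Suc [simp]:
  "griesmer_bound q (Suc k) d = griesmer_bound q k d + griesmer_term q d k"
  by (simp add: griesmer_bound_def griesmer_term_def)

text \<open>The last \<open>j\<close> terms are again a Griesmer bound, for the weight
  \<open>griesmer_term q d i\<close>; this bound governs what lies above a tight subcode of
  dimension \<open>i\<close>.\<close>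

lemma griesmer_bound_add:
  assumes "q > 0"
  shows "griesmer_bound q (i + j) d = griesmer_bound q i d + griesmer_bound q j (griesmer_term q d i)"
  by (induction j) (auto simp: griesmer_term_add[OF assms])

lemma griesmer_bound_mono:
  assumes "q > 0" "d \<le> d'"
  shows "griesmer_bound q k d \<le> griesmer_bound q k d'"
  by (induction k) (auto intro: add_mono griesmer_term_mono[OF assms])

text \<open>The term with index 0 is the weight itself and grows strictly; the other terms do not
  decrease.\<close>

lemma griesmer_bound_Suc_right_less:
  assumes "q > 0" "k > 0"
  shows "griesmer_bound q k d < griesmer_bound q k (Suc d)"
proof -
  obtain r where k: "k = 1 + r" using assms(2) by (metis Suc_pred plus_1_eq_Suc)
  have "griesmer_bound q r (griesmer_term q d 1) \<le> griesmer_bound q r (griesmer_term q (Suc d) 1)"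
    by (intro griesmer_bound_mono griesmer_term_mono assms) simp
  then show ?thesis
    by (simp only: k griesmer_bound_add[OF assms(1)]) simp
qed

section \<open>Effective lengths\<close>

lemma effective_length_mono: "A \<subseteq> B \<Longrightarrow> effective_length A \<le> effective_length B"
  unfolding effective_length_def by (intro card_mono) auto

lemma effective_length_span [simp]:
  fixes A :: "('a::field ^ 'n) set"
  shows "effective_length (vec.span A) = effective_length A"
proof -
  have "(\<exists>x\<in>vec.span A. x $ i \<noteq> 0) \<longleftrightarrow> (\<exists>x\<in>A. x $ i \<noteq> 0)" for i
  proof
    assume "\<exists>x\<in>vec.span A. x $ i \<noteq> 0"
    moreover have "x $ i = 0" if "x \<in> vec.span A" "\<forall>x\<in>A. x $ i = 0" for x
      using that by (induction rule: vec.span_induct_alt) auto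
    ultimately show "\<exists>x\<in>A. x $ i \<noteq> 0" by blast
  qed (use vec.span_base in blast)
  then show ?thesis by (simp add: effective_length_def)
qed

lemma effective_length_insert_0 [simp]:
  "effective_length (insert x {0}) = hamming_weight x" "effective_length {0} = 0"
  by (simp_all add: effective_length_def hamming_weight_def)

text \<open>Compare coordinate by coordinate: one in the support of \<open>D\<close> contributes
  \<open>q + 1\<close> to both sides, one that only \<open>u\<close> or \<open>v\<close> adds
  contributes \<open>q\<close>, and any other contributes 0, where
  \<open>q = CARD('a)\<close>.\<close>

lemma effective_length_pencil:
  fixes D :: "('a::{field,finite} ^ 'n) set"
  shows "effective_length (insert u D) + (\<Sum>c\<in>UNIV. effective_length (insert (v + c *s u) D)) =
    effective_length D + CARD('a) * effective_length (insert v (insert u D))"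
proof -
  let ?I = "\<lambda>A i. if \<exists>x\<in>A. x $ i \<noteq> (0::'a) then 1 else (0::nat)"
  have len: "effective_length A = (\<Sum>i\<in>UNIV. ?I A i)" for A :: "('a ^ 'n) set"
    by (simp add: effective_length_def sum.If_cases)
  have q: "CARD('a) \<ge> 1" by (simp add: Suc_leI)
  have *: "?I (insert u D) i + (\<Sum>c\<in>UNIV. ?I (insert (v + c *s u) D) i) =
      ?I D i + CARD('a) * ?I (insert v (insert u D)) i" for i
  proof (cases "(\<exists>x\<in>D. x $ i \<noteq> 0) \<or> u $ i = 0")
    case True
    then show ?thesis by auto
  next
    case False
    \<comment> \<open>Since \<open>u $ i\<close> is nonzero, exactly one \<open>c\<close> makes
      \<open>v + c *s u\<close> vanish at \<open>i\<close>.\<close>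
    then have "(\<Sum>c\<in>UNIV. ?I (insert (v + c *s u) D) i) =
        (\<Sum>c\<in>UNIV. if c \<noteq> - (v $ i / u $ i) then 1 else 0)"
      by (intro sum.cong) (auto simp: field_simps add_eq_0_iff)
    also have "\<dots> = CARD('a) - 1"
      by (simp add: sum.If_cases card_Diff_singleton_if Collect_neg_eq Compl_eq_Diff_UNIV)
    finally show ?thesis using False q by auto
  qed
  have "effective_length (insert u D) + (\<Sum>c\<in>UNIV. effective_length (insert (v + c *s u) D)) =
      (\<Sum>i\<in>UNIV. ?I (insert u D) i + (\<Sum>c\<in>UNIV. ?I (insert (v + c *s u) D) i))"
    unfolding len sum.distrib by (subst sum.swap) simp
  also have "\<dots> = (\<Sum>i\<in>UNIV. ?I D i + CARD('a) * ?I (insert v (insert u D)) i)"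
    by (simp only: *)
  finally show ?thesis unfolding len sum.distrib sum_distrib_left .
qed

section \<open>Extending a subspace by one vector\<close>

lemma span_insert_within:
  fixes C D :: "('a::field ^ 'n) set"
  assumes "vec.subspace C" "vec.subspace D" "D \<subseteq> C" "x \<in> C - D"
  shows "D \<subseteq> vec.span (insert x D)" "x \<in> vec.span (insert x D)"
    "vec.span (insert x D) \<subseteq> C" "vec.dim (vec.span (insert x D)) = Suc (vec.dim D)"
proof -
  show "D \<subseteq> vec.span (insert x D)" "x \<in> vec.span (insert x D)"
    using vec.span_superset[of "insert x D"] by auto
  show "vec.span (insert x D) \<subseteq> C"
    by (rule vec.span_minimal) (use assms in auto)
  have "x \<notin> vec.span D"
    using assms(2,4) vec.span_eq_iff by blast
  then show "vec.dim (vec.span (insert x D)) = Suc (vec.dim D)"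
    by (simp add: vec.dim_insert)
qed

lemma span_insert_span:
  fixes A :: "('a::field ^ 'n) set"
  shows "vec.span (insert y (vec.span A)) = vec.span (insert y A)"
  by (simp add: vec.span_insert vec.span_span)

lemma effective_length_insert_span [simp]:
  fixes A :: "('a::field ^ 'n) set"
  shows "effective_length (insert y (vec.span A)) = effective_length (insert y A)"
  by (metis effective_length_span span_insert_span)

lemma add_scale_notin_span_insert:
  fixes D :: "('a::field ^ 'n) set"
  assumes "y \<notin> vec.span (insert x D)"
  shows "y + c *s x \<notin> vec.span (insert x D)"
proof
  assume "y + c *s x \<in> vec.span (insert x D)"
  moreover have "c *s x \<in> vec.span (insert x D)" by (simp add: vec.span_base vec.span_scale)
  ultimately have "(y + c *s x) - c *s x \<in> vec.span (insert x D)" by (rule vec.span_diff)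
  with assms show False by simp
qed

text \<open>Extend \<open>D\<close> by an \<open>x\<close> that adds the fewest coordinates, say
  \<open>w'\<close>. Averaging over the pencil through \<open>x\<close> and any further
  \<open>y\<close> shows that the next extension adds at least \<open>w' / q\<close> coordinates,
  rounded up, so the induction continues with that weight.\<close>

lemma griesmer_bound_relative:
  fixes C D :: "('a::{field,finite} ^ 'n) set"
  assumes "vec.subspace C" "vec.subspace D" "D \<subseteq> C" "vec.dim C = vec.dim D + r"
    and "\<And>x. x \<in> C - D \<Longrightarrow> effective_length D + w \<le> effective_length (insert x D)"
  shows "effective_length D + griesmer_bound CARD('a) r w \<le> effective_length C"
  using assms
proof (induction r arbitrary: D w)
  case 0
  then show ?case by (simp add: effective_length_mono)
next
  case (Suc r)
  let ?q = "CARD('a)"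
  have q: "?q > 0" by simp
  have "C - D \<noteq> {}" using Suc.prems(3,4) by auto
  then obtain x where x: "x \<in> C - D"
    and min: "\<And>y. y \<in> C - D \<Longrightarrow> effective_length (insert x D) \<le> effective_length (insert y D)"
    using ex_min_if_finite[of "(\<lambda>x. effective_length (insert x D)) ` (C - D)"]
    by (auto simp: not_less)
  define D' where "D' = vec.span (insert x D)"
  define w' where "w' = effective_length (insert x D) - effective_length D"
  have w': "effective_length (insert x D) = effective_length D + w'" "w \<le> w'"
    using Suc.prems(5)[OF x] by (auto simp: w'_def)
  note D'_props = span_insert_within[OF Suc.prems(1-3) x, folded D'_def]
  have D': "vec.subspace D'" "D' \<subseteq> C" "vec.dim D' = Suc (vec.dim D)"
    "effective_length D' = effective_length D + w'"
    using D'_props w'(1) by (simp_all add: D'_def)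
  have "effective_length D' + griesmer_term ?q w' 1 \<le> effective_length (insert y D')"
    if y: "y \<in> C - D'" for y
  proof -
    have mem: "y + c *s x \<in> C - D" for c
    proof -
      have "y + c *s x \<in> C"
        using x y Suc.prems(1) by (auto intro: vec.subspace_add vec.subspace_scale)
      moreover have "y + c *s x \<notin> D'"
        using y add_scale_notin_span_insert by (auto simp: D'_def)
      ultimately show ?thesis using D'_props(1) by blast
    qed
    have len: "effective_length (insert y (insert x D)) = effective_length (insert y D')"
      by (simp add: D'_def)
    have "(\<Sum>c\<in>(UNIV::'a set). effective_length D + w') \<le>
        (\<Sum>c\<in>UNIV. effective_length (insert (y + c *s x) D))"
      by (intro sum_mono) (metis min mem w'(1))
    then have "(effective_length D + w') + ?q * (effective_length D + w') \<le>
        effective_length D + ?q * effective_length (insert y D')"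
      using effective_length_pencil[of x D y] len w'(1) by simp
    moreover have "effective_length D + w' \<le> effective_length (insert y D')"
      using D'(4) effective_length_mono[of D' "insert y D'"] by auto
    \<comment> \<open>With the increment named \<open>t\<close>, the pencil inequality needs no
      truncated subtraction and cancels to \<open>w' \<le> t * q\<close>.\<close>
    then obtain t where t: "effective_length (insert y D') = effective_length D + w' + t"
      using le_Suc_ex by blast
    ultimately have "w' \<le> t * ?q" by (simp add: algebra_simps)
    then show ?thesis using t D'(4) by (simp add: griesmer_term_le_iff[OF q])
  qed
  moreover have "vec.dim C = vec.dim D' + r" using D' Suc.prems by simp
  ultimately have "effective_length D' + griesmer_bound ?q r (griesmer_term ?q w' 1) \<le> effective_length C"
    using Suc.IH D' Suc.prems(1) by blast
  moreover have "griesmer_bound ?q (Suc r) w' = w' + griesmer_bound ?q r (griesmer_term ?q w' 1)"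
    using griesmer_bound_add[OF q, of 1 r w'] by simp
  ultimately show ?case
    using D'(4) griesmer_bound_mono[OF q w'(2), of "Suc r"] by linarith
qed

section \<open>Tight subcodes\<close>

text \<open>Unlike in \<open>linear_code\<close>, the value \<open>d\<close> need not be attained,
  so the property passes to all subcodes, including the zero code.\<close>

definition min_weight_ge :: "nat \<Rightarrow> ('a::field ^ 'n) set \<Rightarrow> bool" where
  "min_weight_ge d C \<longleftrightarrow> (\<forall>x\<in>C. x \<noteq> 0 \<longrightarrow> d \<le> hamming_weight x)"

text \<open>This admits the zero code, the start of all chains of subcodes. That weight
  \<open>d\<close> occurs in positive dimension is recovered in
  \<open>griesmer_code_iff_tight\<close>.\<close>

definition tight :: "nat \<Rightarrow> ('a::{field,finite} ^ 'n) set \<Rightarrow> bool" where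
  "tight d D \<longleftrightarrow> vec.subspace D \<and> effective_length D = griesmer_bound CARD('a) (vec.dim D) d"

lemma min_weight_ge_subset: "min_weight_ge d C \<Longrightarrow> D \<subseteq> C \<Longrightarrow> min_weight_ge d D"
  by (auto simp: min_weight_ge_def)

lemma tight_0: "tight d {0}"
  by (simp add: tight_def)

text \<open>The classical Griesmer bound is the relative one over the zero code, where an extension
  by \<open>x\<close> has the weight of \<open>x\<close> as its length.\<close>

lemma griesmer_bound_le_effective_length:
  fixes D :: "('a::{field,finite} ^ 'n) set"
  assumes "vec.subspace D" "min_weight_ge d D"
  shows "griesmer_bound CARD('a) (vec.dim D) d \<le> effective_length D"
  using griesmer_bound_relative[of D "{0}" "vec.dim D" d] assms
  by (auto simp: min_weight_ge_def vec.subspace_0)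

lemma griesmer_bound_le_insert:
  fixes C D :: "('a::{field,finite} ^ 'n) set"
  assumes "vec.subspace C" "vec.subspace D" "D \<subseteq> C" "x \<in> C - D" "min_weight_ge d C"
  shows "griesmer_bound CARD('a) (Suc (vec.dim D)) d \<le> effective_length (insert x D)"
proof -
  note within = span_insert_within[OF assms(1-4)]
  have "griesmer_bound CARD('a) (vec.dim (vec.span (insert x D))) d \<le>
      effective_length (vec.span (insert x D))"
    by (intro griesmer_bound_le_effective_length min_weight_ge_subset[OF assms(5)] within)
      simp
  then show ?thesis unfolding within(4) by simp
qed

lemma tight_span_insert_iff:
  fixes C D :: "('a::{field,finite} ^ 'n) set"
  assumes "vec.subspace C" "vec.subspace D" "D \<subseteq> C" "x \<in> C - D"
  shows "tight d (vec.span (insert x D)) \<longleftrightarrow>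
    effective_length (insert x D) = griesmer_bound CARD('a) (Suc (vec.dim D)) d"
  using span_insert_within(4)[OF assms] unfolding tight_def by simp

text \<open>If every one-step extension added more than the Griesmer term at
  \<open>vec.dim D\<close>, the relative bound with the next larger weight would exceed the length
  of \<open>C\<close>.\<close>

lemma tight_extension:
  fixes C D :: "('a::{field,finite} ^ 'n) set"
  assumes C: "tight d C" "min_weight_ge d C" and D: "tight d D" "D \<subseteq> C" "D \<noteq> C"
  obtains x where "x \<in> C - D" "tight d (vec.span (insert x D))"
proof -
  let ?q = "CARD('a)"
  have sub: "vec.subspace C" "vec.subspace D" using C D by (auto simp: tight_def)
  define r where "r = vec.dim C - vec.dim D"
  have r: "vec.dim C = vec.dim D + r" "r > 0"
    using vec.dim_subset[OF D(2)] vec.subspace_dim_equal[OF sub(2,1) D(2)] D(3)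
    by (auto simp: r_def)
  let ?w = "griesmer_term ?q d (vec.dim D)"
  have "\<exists>x\<in>C - D. effective_length (insert x D) \<le> effective_length D + ?w"
  proof (rule ccontr)
    assume "\<not> ?thesis"
    then have "effective_length D + griesmer_bound ?q r (Suc ?w) \<le> effective_length C"
      by (intro griesmer_bound_relative sub D r) (force simp: not_le)
    moreover have "effective_length C = effective_length D + griesmer_bound ?q r ?w"
      using C(1) D(1) r(1) by (simp add: tight_def griesmer_bound_add)
    ultimately show False using griesmer_bound_Suc_right_less[of ?q r ?w] r(2) by simp
  qed
  then obtain x where x: "x \<in> C - D" "effective_length (insert x D) \<le> effective_length D + ?w"
    by blast
  have "effective_length (insert x D) = griesmer_bound ?q (Suc (vec.dim D)) d"
    using griesmer_bound_le_insert[OF sub D(2) x(1) C(2)] x(2) D(1) by (simp add: tight_def)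
  then show ?thesis
    using that x(1) tight_span_insert_iff[OF sub D(2) x(1)] by blast
qed

text \<open>Extend twice, by \<open>x\<close> and then by \<open>v\<close>, and look at the pencil
  between \<open>D\<close> and the result. Were the code through \<open>x\<close> its only tight
  member, the other \<open>q\<close> would each be too long by at least one, more than the rounding
  allows.\<close>

lemma two_tight_extensions:
  fixes C D :: "('a::{field,finite} ^ 'n) set"
  assumes C: "tight d C" "min_weight_ge d C" and D: "tight d D" "D \<subseteq> C" "vec.dim D + 2 \<le> vec.dim C"
  obtains x y where "x \<in> C - D" "tight d (vec.span (insert x D))"
    "y \<in> C - vec.span (insert x D)" "tight d (vec.span (insert y D))"
proof -
  let ?q = "CARD('a)"
  have q: "?q > 0" by simp
  have sub: "vec.subspace C" "vec.subspace D" using C D by (auto simp: tight_def)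
  obtain x where x: "x \<in> C - D" "tight d (vec.span (insert x D))"
    using tight_extension[OF C D(1,2)] D(3) by force
  let ?Dx = "vec.span (insert x D)"
  note Dx = span_insert_within[OF sub D(2) x(1)]
  obtain v where v: "v \<in> C - ?Dx" "tight d (vec.span (insert v ?Dx))"
    using tight_extension[OF C x(2) Dx(3)] D(3) Dx(4) by force
  let ?g = "\<lambda>j. griesmer_bound ?q (j + vec.dim D) d"
  have lens: "effective_length D = ?g 0" "effective_length (insert x D) = ?g 1"
    using D(1) x(2) Dx(4) by (simp_all add: tight_def)
  have len2: "effective_length (insert v (insert x D)) = ?g 2"
    using v(2) tight_span_insert_iff[OF sub(1) vec.subspace_span Dx(3) v(1)]
    unfolding Dx(4) by simp
  have y: "v + c *s x \<in> C - ?Dx" for c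
    using v(1) x(1) add_scale_notin_span_insert[of v x D c] sub(1)
    by (auto intro: vec.subspace_add vec.subspace_scale)
  have "\<exists>c. effective_length (insert (v + c *s x) D) \<le> ?g 1"
  proof (rule ccontr)
    assume "\<not> ?thesis"
    then have "(\<Sum>c\<in>(UNIV::'a set). ?g 1 + 1) \<le> (\<Sum>c\<in>UNIV. effective_length (insert (v + c *s x) D))"
      by (intro sum_mono) (auto simp: not_le Suc_le_eq)
    then have "?g 1 + ?q * (?g 1 + 1) \<le> ?g 0 + ?q * ?g 2"
      using effective_length_pencil[of x D v] lens len2 by simp
    \<comment> \<open>After cancellation, the Griesmer term at \<open>vec.dim D\<close> plus
      \<open>q\<close> is at most \<open>q\<close> times the next term.\<close>
    then show False
      using griesmer_term_Suc_less[OF q, of d "vec.dim D"] by (simp add: algebra_simps)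
  qed
  then obtain c where c: "effective_length (insert (v + c *s x) D) \<le> ?g 1" by blast
  have y': "v + c *s x \<in> C - D" using y[of c] Dx(1) by blast
  have "tight d (vec.span (insert (v + c *s x) D))"
    using griesmer_bound_le_insert[OF sub D(2) y' C(2)] c
    by (simp add: tight_span_insert_iff[OF sub D(2) y'])
  then show ?thesis using that x y by blast
qed

text \<open>Two different tight one-step extensions of \<open>D\<close> meet only in
  \<open>D\<close>, so one of them misses \<open>z\<close>; induction on the codimension climbs from
  that one to a hyperplane.\<close>

lemma tight_separation:
  fixes C D :: "('a::{field,finite} ^ 'n) set"
  assumes C: "tight d C" "min_weight_ge d C" and D: "tight d D" "D \<subseteq> C" and z: "z \<in> C - D"
  shows "\<exists>E. tight d E \<and> D \<subseteq> E \<and> E \<subseteq> C \<and> Suc (vec.dim E) = vec.dim C \<and> z \<notin> E"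
  using D z
proof (induction "vec.dim C - vec.dim D" arbitrary: D rule: less_induct)
  case less
  have sub: "vec.subspace C" "vec.subspace D" using C less.prems by (auto simp: tight_def)
  have "vec.dim D < vec.dim C"
    using vec.subspace_dim_equal[OF sub(2,1) less.prems(2)] less.prems(3) by (cases "vec.dim C \<le> vec.dim D") auto
  then consider "Suc (vec.dim D) = vec.dim C" | "vec.dim D + 2 \<le> vec.dim C" by linarith
  then show ?case
  proof cases
    case 1
    then show ?thesis using less.prems by blast
  next
    case 2
    obtain x y where x: "x \<in> C - D" "tight d (vec.span (insert x D))"
      and y: "y \<in> C - vec.span (insert x D)" "tight d (vec.span (insert y D))"
      using two_tight_extensions[OF C less.prems(1,2) 2] .
    note Dx = span_insert_within[OF sub less.prems(2) x(1)]
    have y': "y \<in> C - D" using y(1) Dx(1) by blast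
    note Dy = span_insert_within[OF sub less.prems(2) y']
    have "z \<notin> vec.span (insert x D) \<or> z \<notin> vec.span (insert y D)"
    proof (rule ccontr)
      assume "\<not> ?thesis"
      then have zx: "z \<in> vec.span (insert x D)" and "z \<in> vec.span (insert y D)" by auto
      moreover have "z \<notin> vec.span D" using less.prems(3) sub(2) vec.span_eq_iff by blast
      \<comment> \<open>By exchange, a \<open>z\<close> outside \<open>D\<close> in both extensions
        would force them to coincide.\<close>
      ultimately have "y \<in> vec.span (insert z D)" by (simp add: vec.in_span_insert)
      moreover have "vec.span (insert z D) \<subseteq> vec.span (insert x D)"
        using zx Dx(1) by (intro vec.span_minimal) auto
      ultimately show False using y(1) by blast
    qed
    then show ?thesis
    proof
      assume "z \<notin> vec.span (insert x D)"
      then have "\<exists>E. tight d E \<and> vec.span (insert x D) \<subseteq> E \<and> E \<subseteq> C \<and> Suc (vec.dim E) = vec.dim C \<and> z \<notin> E"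
        using less.prems(3) x(2) 2 by (intro less.hyps Dx(3)) (simp_all add: Dx(4) del: vec.dim_span)
      then show ?thesis using Dx(1) by blast
    next
      assume "z \<notin> vec.span (insert y D)"
      then have "\<exists>E. tight d E \<and> vec.span (insert y D) \<subseteq> E \<and> E \<subseteq> C \<and> Suc (vec.dim E) = vec.dim C \<and> z \<notin> E"
        using less.prems(3) y(2) 2 by (intro less.hyps Dy(3)) (simp_all add: Dy(4) del: vec.dim_span)
      then show ?thesis using Dy(1) by blast
    qed
  qed
qed

text \<open>Divisibility makes every one-step extension tight, not just some. Take a tight extension
  by \<open>u\<close>; if it misses \<open>x\<close>, extending it by \<open>x\<close> is tight by
  induction, and the pencil between \<open>T\<close> and the result has average length equal to the
  least possible one.\<close>

lemma tight_between:
  fixes T F :: "('a::{field,finite} ^ 'n) set"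
  assumes F: "tight d F" "min_weight_ge d F" and T: "tight d T" "T \<subseteq> F"
    and dvd: "CARD('a) ^ e dvd d" "vec.dim F \<le> e + 1" and x: "x \<in> F - T"
  shows "tight d (vec.span (insert x T))"
  using T x
proof (induction "vec.dim F - vec.dim T" arbitrary: T rule: less_induct)
  case less
  let ?q = "CARD('a)"
  have q: "?q > 0" by simp
  have sub: "vec.subspace F" "vec.subspace T" using F less.prems by (auto simp: tight_def)
  obtain u where u: "u \<in> F - T" "tight d (vec.span (insert u T))"
    using tight_extension[OF F less.prems(1,2)] less.prems(3) by blast
  let ?Tu = "vec.span (insert u T)"
  note Tu = span_insert_within[OF sub less.prems(2) u(1)]
  note Tx = span_insert_within[OF sub less.prems(2) less.prems(3)]
  show ?case
  proof (cases "x \<in> ?Tu")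
    case True
    then have "vec.span (insert x T) \<subseteq> ?Tu"
      using Tu(1) by (intro vec.span_minimal) auto
    then have "vec.span (insert x T) = ?Tu"
      using Tu(4) Tx(4) by (intro vec.subspace_dim_equal) auto
    then show ?thesis using u(2) by simp
  next
    case False
    then have x': "x \<in> F - ?Tu" using less.prems(3) by blast
    note Tux = span_insert_within[OF sub(1) vec.subspace_span Tu(3) x']
    have le: "vec.dim T + 2 \<le> vec.dim F"
      using vec.dim_subset[OF Tux(3)] unfolding Tux(4) Tu(4) by simp
    have "tight d (vec.span (insert x ?Tu))"
      using less.hyps[of ?Tu] Tu u(2) x' le by simp
    let ?g = "\<lambda>j. griesmer_bound ?q (j + vec.dim T) d"
    have lens: "effective_length T = ?g 0" "effective_length (insert u T) = ?g 1"
      using less.prems(1) u(2) Tu(4) by (simp_all add: tight_def)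
    have len2: "effective_length (insert x (insert u T)) = ?g 2"
      using \<open>tight d (vec.span (insert x ?Tu))\<close>
        tight_span_insert_iff[OF sub(1) vec.subspace_span Tu(3) x']
      unfolding Tu(4) by simp
    have ge: "?g 1 \<le> effective_length (insert (x + c *s u) T)" for c
    proof -
      have "x + c *s u \<in> F - ?Tu"
        using x' u(1) add_scale_notin_span_insert[of x u T c] sub(1)
        by (auto intro: vec.subspace_add vec.subspace_scale)
      then show ?thesis
        using griesmer_bound_le_insert[OF sub less.prems(2) _ F(2)] Tu(1) by fastforce
    qed
    \<comment> \<open>Two dimensions remain above \<open>T\<close>, so
      \<open>vec.dim T + 1 \<le> e\<close>; this is where the limit \<open>e + 1\<close> comes
      from.\<close>
    have "?q ^ Suc (vec.dim T) dvd ?q ^ e"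
      using le dvd(2) by (intro le_imp_power_dvd) simp
    then have "?q ^ Suc (vec.dim T) dvd d" using dvd(1) by (rule dvd_trans)
    then have "griesmer_term ?q d (vec.dim T) = ?q * griesmer_term ?q d (Suc (vec.dim T))"
      by (intro griesmer_term_Suc_dvd q)
    then have "(\<Sum>c\<in>UNIV. effective_length (insert (x + c *s u) T)) = (\<Sum>c\<in>(UNIV::'a set). ?g 1)"
      using effective_length_pencil[of u T x] lens len2 by (simp add: algebra_simps)
    \<comment> \<open>Every summand is at least the bound and the sums agree, so all are equal;
      \<open>c = 0\<close> gives the extension by \<open>x\<close>.\<close>
    then have "effective_length (insert (x + 0 *s u) T) = ?g 1"
      using sum_mono_inv[of "\<lambda>_. ?g 1" UNIV "\<lambda>c. effective_length (insert (x + c *s u) T)" 0] ge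
      by simp
    then show ?thesis by (simp add: tight_span_insert_iff[OF sub less.prems(2,3)])
  qed
qed

text \<open>Over the zero code, tightness of the line through \<open>x\<close> says that
  \<open>x\<close> has weight \<open>d\<close>.\<close>

lemma tight_constant_weight:
  fixes D :: "('a::{field,finite} ^ 'n) set"
  assumes "tight d D" "min_weight_ge d D" "CARD('a) ^ e dvd d" "vec.dim D \<le> e + 1"
    and "x \<in> D" "x \<noteq> 0"
  shows "hamming_weight x = d"
proof -
  have sub: "vec.subspace D" "vec.subspace {0}" "{0} \<subseteq> D" "x \<in> D - {0}"
    using assms by (auto simp: tight_def vec.subspace_0)
  from tight_between[OF assms(1,2) tight_0 sub(3) assms(3,4) sub(4)]
  show ?thesis using tight_span_insert_iff[OF sub] by simp
qed

text \<open>A word of weight exactly \<open>d\<close> comes from a tight extension of the zero code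
  inside \<open>D\<close>.\<close>

lemma griesmer_code_iff_tight:
  fixes D :: "('a::{field,finite} ^ 'n) set"
  assumes "min_weight_ge d D" "k > 0"
  shows "griesmer_code k d D \<longleftrightarrow> tight d D \<and> vec.dim D = k"
proof (intro iffI conjI)
  assume "tight d D \<and> vec.dim D = k"
  then have D: "tight d D" "vec.dim D = k" by auto
  then have sub: "vec.subspace D" "vec.subspace {0::'a ^ 'n}" "{0} \<subseteq> D" "{0} \<noteq> D"
    using assms(2) by (auto simp: tight_def vec.subspace_0)
  obtain x where x: "x \<in> D - {0}" "tight d (vec.span (insert x {0}))"
    using tight_extension[OF D(1) assms(1) tight_0 sub(3,4)] .
  have "hamming_weight x = d"
    using tight_span_insert_iff[OF sub(1-3) x(1)] x(2) by simp
  with x(1) D sub(1) assms(1) show "griesmer_code k d D"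
    by (auto simp: griesmer_code_def linear_code_def min_weight_ge_def tight_def)
qed (auto simp: griesmer_code_def linear_code_def tight_def)

lemma tight_subcode_of_dim:
  fixes C :: "('a::{field,finite} ^ 'n) set"
  assumes C: "tight d C" "min_weight_ge d C" and "m \<le> vec.dim C"
  shows "\<exists>D. tight d D \<and> D \<subseteq> C \<and> vec.dim D = m"
  using assms(3)
proof (induction m)
  case 0
  have "{0} \<subseteq> C" using C(1) by (auto simp: tight_def vec.subspace_0)
  then show ?case using tight_0 by (metis vec.dim_eq_0 subset_refl)
next
  case (Suc m)
  then obtain D where D: "tight d D" "D \<subseteq> C" "vec.dim D = m" by auto
  then have sub: "vec.subspace C" "vec.subspace D" "D \<noteq> C"
    using C(1) Suc.prems by (auto simp: tight_def)
  obtain x where x: "x \<in> C - D" "tight d (vec.span (insert x D))"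
    using tight_extension[OF C D(1,2) sub(3)] .
  show ?case using span_insert_within[OF sub(1,2) D(2) x(1)] x(2) D(3) by blast
qed

section \<open>Dual bases of hyperplanes\<close>

text \<open>The vector \<open>x\<close> spans a complement of \<open>E\<close> in \<open>C\<close>.
  As \<open>x\<close> lies in \<open>V\<close>, the component in \<open>E\<close> of a vector of
  \<open>V\<close> stays in \<open>V\<close>, so \<open>x\<close> also complements
  \<open>V \<inter> E\<close> in \<open>V\<close>.\<close>

lemma dim_Int_hyperplane:
  fixes C :: "('a::field ^ 'n) set"
  assumes C: "vec.subspace C" and E: "vec.subspace E" "E \<subseteq> C" "Suc (vec.dim E) = vec.dim C"
    and V: "vec.subspace V" "V \<subseteq> C" and x: "x \<in> V" "x \<notin> E"
  shows "Suc (vec.dim (V \<inter> E)) = vec.dim V"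
proof -
  have xC: "x \<in> C - E" using x V by blast
  note Ex = span_insert_within[OF C E(1,2) xC]
  have "vec.span (insert x E) = C"
    using Ex(3,4) E(3) C by (intro vec.subspace_dim_equal) (auto simp del: vec.dim_span)
  have VE: "vec.subspace (V \<inter> E)" using V(1) E(1) by (rule vec.subspace_inter)
  have xV: "x \<in> V - V \<inter> E" using x by blast
  note VEx = span_insert_within[OF V(1) VE Int_lower1 xV]
  have "V \<subseteq> vec.span (insert x (V \<inter> E))"
  proof
    fix v assume v: "v \<in> V"
    then have "v \<in> vec.span (insert x E)"
      using \<open>vec.span (insert x E) = C\<close> V(2) by blast
    then obtain c where "v - c *s x \<in> E"
      using E(1) vec.span_eq_iff by (metis vec.span_breakdown_eq)
    moreover have "v - c *s x \<in> V"
      using v x(1) V(1) by (intro vec.subspace_diff vec.subspace_scale)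
    ultimately show "v \<in> vec.span (insert x (V \<inter> E))"
      unfolding vec.span_breakdown_eq by (blast intro: vec.span_base)
  qed
  then have "vec.span (insert x (V \<inter> E)) = V" using VEx(3) by blast
  then show ?thesis using VEx(4) by simp
qed

text \<open>Keep cutting \<open>V\<close> by a member of \<open>H\<close> that misses a vector
  outside \<open>D\<close>; each cut costs one dimension. The member with index \<open>t\<close>
  cuts from dimension \<open>t + 1\<close> to \<open>t\<close>, so families for consecutive
  dimension ranges can be glued.\<close>

lemma independent_hyperplanes_exist:
  fixes C D V :: "('a::field ^ 'n) set"
  assumes C: "vec.subspace C" and D: "vec.subspace D"
    and H: "\<And>E. E \<in> H \<Longrightarrow> vec.subspace E \<and> E \<subseteq> C \<and> Suc (vec.dim E) = vec.dim C \<and> D \<subseteq> E"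
    and V: "vec.subspace V" "V \<subseteq> C" "D \<subseteq> V"
    and sep: "\<And>x. x \<in> V - D \<Longrightarrow> \<exists>E\<in>H. x \<notin> E"
  shows "\<exists>E. (\<forall>i\<in>{vec.dim D..<vec.dim V}. E i \<in> H) \<and> V \<inter> (\<Inter>i\<in>{vec.dim D..<vec.dim V}. E i) = D"
  using V sep
proof (induction "vec.dim V" arbitrary: V)
  case 0
  then have "V \<subseteq> D" using D vec.subspace_0 by fastforce
  with 0 show ?case by auto
next
  case (Suc t)
  show ?case
  proof (cases "V = D")
    case True
    then show ?thesis by simp
  next
    case False
    then obtain x E where x: "x \<in> V" "x \<notin> D" "E \<in> H" "x \<notin> E"
      using Suc.prems(3,4) by blast
    note E = H[OF x(3)]
    have dim: "Suc (vec.dim (V \<inter> E)) = Suc t"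
      using dim_Int_hyperplane[OF C _ _ _ Suc.prems(1,2) x(1,4)] E Suc.hyps(2) by simp
    have "vec.dim D \<le> t"
      using vec.dim_subset[of D "V \<inter> E"] E Suc.prems(3) dim by auto
    have VE: "vec.subspace (V \<inter> E)" using E Suc.prems(1) by (intro vec.subspace_inter) auto
    obtain F where F: "\<forall>i\<in>{vec.dim D..<t}. F i \<in> H" "(V \<inter> E) \<inter> (\<Inter>i\<in>{vec.dim D..<t}. F i) = D"
      using Suc.hyps(1)[of "V \<inter> E"] dim VE E Suc.prems by auto
    have "{vec.dim D..<vec.dim V} = insert t {vec.dim D..<t}"
      using \<open>vec.dim D \<le> t\<close> Suc.hyps(2) by auto
    then show ?thesis
      using F x(3) by (intro exI[of _ "F(t := E)"]) auto
  qed
qed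

text \<open>Each hyperplane lowers the dimension by at most one, so any \<open>k - 1\<close> of them
  share a nonzero vector, which the remaining one must miss.\<close>

lemma dual_basis_exists:
  fixes C :: "('a::field ^ 'n) set"
  assumes C: "vec.subspace C" "vec.dim C = k"
    and E: "\<And>i. i < k \<Longrightarrow> vec.subspace (E i) \<and> E i \<subseteq> C \<and> Suc (vec.dim (E i)) = vec.dim C"
    and Int: "C \<inter> (\<Inter>i<k. E i) = {0}"
  obtains a where "generator_matrix k a C" "\<And>i j. i < k \<Longrightarrow> j < k \<Longrightarrow> a i \<in> E j \<longleftrightarrow> i \<noteq> j"
proof -
  have dim: "vec.subspace (C \<inter> (\<Inter>i\<in>A. E i)) \<and> k \<le> vec.dim (C \<inter> (\<Inter>i\<in>A. E i)) + card A"
    if "finite A" "A \<subseteq> {..<k}" for A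
    using that
  proof (induction A)
    case empty
    then show ?case using C by simp
  next
    case (insert j A)
    let ?V = "C \<inter> (\<Inter>i\<in>A. E i)"
    have IH: "vec.subspace ?V" "k \<le> vec.dim ?V + card A" using insert by auto
    have Ej: "vec.subspace (E j)" "E j \<subseteq> C" "Suc (vec.dim (E j)) = vec.dim C"
      using E[of j] insert.prems by auto
    have eq: "C \<inter> (\<Inter>i\<in>insert j A. E i) = ?V \<inter> E j" by blast
    have "vec.dim ?V \<le> Suc (vec.dim (?V \<inter> E j))"
    proof (cases "?V \<subseteq> E j")
      case True
      then have "?V \<inter> E j = ?V" by blast
      then show ?thesis by simp
    next
      case False
      then obtain x where "x \<in> ?V" "x \<notin> E j" by blast
      then show ?thesis using dim_Int_hyperplane[OF C(1) Ej IH(1)] by force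
    qed
    moreover have "vec.subspace (?V \<inter> E j)" using IH(1) Ej(1) by (rule vec.subspace_inter)
    ultimately show ?case unfolding eq using IH(2) insert.hyps by simp
  qed
  have "\<exists>x. x \<in> C \<and> (\<forall>j<k. x \<in> E j \<longleftrightarrow> i \<noteq> j)" if i: "i < k" for i
  proof -
    have "vec.dim (C \<inter> (\<Inter>j\<in>{..<k} - {i}. E j)) > 0"
      using dim[of "{..<k} - {i}"] i by auto
    then obtain x where x: "x \<in> C \<inter> (\<Inter>j\<in>{..<k} - {i}. E j)" "x \<noteq> 0"
      by (metis vec.dim_eq_0 less_irrefl singletonI subsetI)
    then have "x \<notin> E i" using Int i by blast
    with x show ?thesis by blast
  qed
  then obtain a where a: "\<And>i. i < k \<Longrightarrow> a i \<in> C" "\<And>i j. i < k \<Longrightarrow> j < k \<Longrightarrow> a i \<in> E j \<longleftrightarrow> i \<noteq> j"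
    by metis
  have inj: "inj_on a {..<k}" by (rule inj_onI) (metis a(2) lessThan_iff)
  have ind: "vec.independent (a ` {..<k})"
    unfolding vec.dependent_def
  proof clarify
    fix i assume i: "i < k" "a i \<in> vec.span (a ` {..<k} - {a i})"
    \<comment> \<open>The hyperplane \<open>E i\<close> contains all rows except \<open>a i\<close>,
      so it separates \<open>a i\<close> from the span of the others.\<close>
    have "vec.span (a ` {..<k} - {a i}) \<subseteq> E i"
      by (rule vec.span_minimal) (use a(2) i(1) E in auto)
    then show False using i a(2) by blast
  qed
  have "vec.span (a ` {..<k}) = C"
  proof (rule vec.subspace_dim_equal)
    show "vec.span (a ` {..<k}) \<subseteq> C" by (rule vec.span_minimal) (use a(1) C in auto)
    show "vec.dim C \<le> vec.dim (vec.span (a ` {..<k}))"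
      using vec.dim_span_eq_card_independent[OF ind] card_image[OF inj] C(2) by simp
  qed (use C in auto)
  then have "generator_matrix k a C" using inj ind by (simp add: generator_matrix_def)
  then show ?thesis using that a(2) by blast
qed

lemma span_rows_eq:
  fixes C W :: "('a::field ^ 'n) set"
  assumes "generator_matrix k a C" "J \<subseteq> {..<k}" "vec.subspace W" "a ` J \<subseteq> W" "vec.dim W = card J"
  shows "vec.span (a ` J) = W"
proof (rule vec.subspace_dim_equal)
  have inj: "inj_on a J" and ind: "vec.independent (a ` J)"
    using assms(1,2) inj_on_subset vec.independent_mono[OF _ image_mono]
    unfolding generator_matrix_def by blast+
  show "vec.dim W \<le> vec.dim (vec.span (a ` J))"
    using vec.dim_span_eq_card_independent[OF ind] card_image[OF inj] assms(5) by simp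
  show "vec.span (a ` J) \<subseteq> W" by (rule vec.span_minimal) (use assms in auto)
qed (use assms in auto)

section \<open>The generator matrix dual to tight hyperplanes\<close>

theorem theorem4p6:
  fixes C :: "('a::{field,finite} ^ 'n) set" and k d e :: nat
  assumes "griesmer_code k d C"
    and "CARD('n) = griesmer_bound CARD('a) k d"
    and "full_length C"
    and "CARD('a) ^ e dvd d"
  shows "\<exists>a. generator_matrix k a C \<and>
    griesmer_code (min (e + 1) k) d (vec.span (a ` {..<min (e + 1) k})) \<and>
    (\<forall>x \<in> vec.span (a ` {..<min (e + 1) k}). x \<noteq> 0 \<longrightarrow> hamming_weight x = d) \<and>
    (2 \<le> k \<longrightarrow> (\<forall>J. J \<subseteq> {..<k} \<and> card J = k - 1 \<longrightarrow>
       griesmer_code (k - 1) d (vec.span (a ` J))))"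
proof -
  let ?m = "min (e + 1) k"
  have code: "linear_code k d C" using assms(1) by (simp add: griesmer_code_def)
  then have C: "vec.subspace C" "vec.dim C = k" and mw: "min_weight_ge d C"
    by (auto simp: linear_code_def min_weight_ge_def)
  have "k > 0"
  proof (rule ccontr)
    assume "\<not> k > 0"
    then have "C \<subseteq> {0}" using C(2) by simp
    then show False using code by (auto simp: linear_code_def)
  qed
  then have tC: "tight d C" using griesmer_code_iff_tight[OF mw] assms(1) by blast
  obtain D where D: "tight d D" "D \<subseteq> C" "vec.dim D = ?m"
    using tight_subcode_of_dim[OF tC mw, of ?m] C(2) by auto
  have subD: "vec.subspace D" using D(1) by (simp add: tight_def)
  define H where "H = {E. tight d E \<and> E \<subseteq> C \<and> Suc (vec.dim E) = vec.dim C}"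
  have H: "vec.subspace E \<and> E \<subseteq> C \<and> Suc (vec.dim E) = vec.dim C" if "E \<in> H" for E
    using that by (simp add: H_def tight_def)
  have sepD: "\<exists>E\<in>{E \<in> H. D \<subseteq> E}. x \<notin> E" if "x \<in> C - D" for x
    using tight_separation[OF tC mw D(1,2) that] unfolding H_def by blast
  have "\<exists>E. (\<forall>i\<in>{vec.dim D..<vec.dim C}. E i \<in> {E \<in> H. D \<subseteq> E}) \<and>
      C \<inter> (\<Inter>i\<in>{vec.dim D..<vec.dim C}. E i) = D"
    using independent_hyperplanes_exist[of C D "{E \<in> H. D \<subseteq> E}" C, OF C(1) subD _ C(1) order_refl D(2) sepD]
      H by blast
  then obtain E where E: "\<And>i. ?m \<le> i \<Longrightarrow> i < k \<Longrightarrow> E i \<in> H"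
    "C \<inter> (\<Inter>i\<in>{?m..<k}. E i) = D"
    unfolding C(2) D(3) by (metis (no_types, lifting) atLeastLessThan_iff mem_Collect_eq)
  have zero: "vec.subspace {0::'a ^ 'n}" "{0} \<subseteq> C" "{0} \<subseteq> D"
    using C(1) subD by (auto simp: vec.subspace_0)
  have sep0: "\<exists>E\<in>H. x \<notin> E" if "x \<in> D - {0}" for x
    using tight_separation[OF tC mw tight_0 zero(2), of x] that D(2) unfolding H_def by blast
  have H0: "vec.subspace E \<and> E \<subseteq> C \<and> Suc (vec.dim E) = vec.dim C \<and> {0} \<subseteq> E" if "E \<in> H" for E
    using H[OF that] by (auto simp: vec.subspace_0)
  have "vec.dim {0::'a ^ 'n} = 0" by simp
  then obtain F where F: "\<And>i. i < ?m \<Longrightarrow> F i \<in> H" "D \<inter> (\<Inter>i<?m. F i) = {0}"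
    using independent_hyperplanes_exist[of C "{0}" H D, OF C(1) zero(1) H0 subD D(2) zero(3) sep0]
    unfolding D(3) by (metis atLeast0LessThan lessThan_iff)
  \<comment> \<open>The indices from \<open>?m\<close> on cut \<open>C\<close> down to
    \<open>D\<close>, those below \<open>?m\<close> cut \<open>D\<close> down to 0. A dual row with
    index below \<open>?m\<close> lies in all the former, hence in \<open>D\<close>.\<close>
  define G where "G i = (if i < ?m then F i else E i)" for i
  have G: "G i \<in> H" if "i < k" for i using E(1) F(1) that by (simp add: G_def)
  have "(\<Inter>i<k. G i) = (\<Inter>i\<in>{?m..<k}. E i) \<inter> (\<Inter>i<?m. F i)"
  proof -
    have "{..<k} = {?m..<k} \<union> {..<?m}" by auto
    moreover have "(\<Inter>i\<in>{?m..<k}. G i) = (\<Inter>i\<in>{?m..<k}. E i)"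
      by (intro INF_cong) (auto simp: G_def)
    moreover have "(\<Inter>i<?m. G i) = (\<Inter>i<?m. F i)"
      by (intro INF_cong) (auto simp: G_def)
    ultimately show ?thesis by (simp only: INF_union)
  qed
  then have Int: "C \<inter> (\<Inter>i<k. G i) = {0}"
    by (simp only: Int_assoc[symmetric] E(2) F(2))
  obtain a where a: "generator_matrix k a C" "\<And>i j. i < k \<Longrightarrow> j < k \<Longrightarrow> a i \<in> G j \<longleftrightarrow> i \<noteq> j"
    using dual_basis_exists[of C k G, OF C H[OF G] Int] by blast
  have aC: "a i \<in> C" if "i < k" for i
    using a(1) that vec.span_base[of "a i" "a ` {..<k}"] by (auto simp: generator_matrix_def)
  have spanD: "vec.span (a ` {..<?m}) = D"
  proof (rule span_rows_eq[OF a(1)])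
    show "a ` {..<?m} \<subseteq> D"
    proof clarify
      fix i assume i: "i < ?m"
      have "a i \<in> E j" if "j \<in> {?m..<k}" for j
      proof -
        have "G j = E j" "i < k" "j < k" "i \<noteq> j" using i that by (auto simp: G_def)
        then show ?thesis using a(2) by metis
      qed
      with i show "a i \<in> D" using aC[of i] E(2) by auto
    qed
  qed (use subD D(3) in auto)
  note mwD = min_weight_ge_subset[OF mw D(2)]
  have "griesmer_code ?m d D"
    using griesmer_code_iff_tight[OF mwD, of ?m] D \<open>k > 0\<close> by simp
  moreover have "\<forall>x\<in>D. x \<noteq> 0 \<longrightarrow> hamming_weight x = d"
    using tight_constant_weight[OF D(1) mwD assms(4)] D(3) by simp
  moreover have "griesmer_code (k - 1) d (vec.span (a ` J))"
    if J: "2 \<le> k" "J \<subseteq> {..<k}" "card J = k - 1" for J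
  proof -
    have "J \<noteq> {..<k}" using J by auto
    then obtain i where i: "i < k" "i \<notin> J" using J(2) by blast
    note Gi = H[OF G[OF i(1)]]
    \<comment> \<open>Omitting row \<open>i\<close> leaves \<open>k - 1\<close> independent vectors
      in the hyperplane \<open>G i\<close>, which is tight by the choice of
      \<open>H\<close>.\<close>
    have "vec.span (a ` J) = G i"
    proof (rule span_rows_eq[OF a(1) J(2)])
      show "a ` J \<subseteq> G i" using a(2) i J(2) by blast
    qed (use Gi C(2) J(3) in auto)
    moreover have "griesmer_code (k - 1) d (G i)"
      using griesmer_code_iff_tight[OF min_weight_ge_subset[OF mw], of "G i" "k - 1"]
        Gi G[OF i(1)] C(2) J(1) by (auto simp: H_def)
    ultimately show ?thesis by simp
  qed
  ultimately show ?thesis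
    by (intro exI[of _ a] conjI allI impI) (simp_all only: spanD a(1))
qed

end
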